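(* Let $\mathcal{A}:\mathbb{R}^{m\times n}\to\mathbb{R}^l$ be a linear map, let $k\ge6$ be an integer, $\lambda>0$, $\epsilon\ge0$, and let $\bm{b}=\mathcal{A}(\bm{X}^o)+\bm{s}$ with $\bm{X}^o\in\mathbb{R}^{m\times n}$ and $\|\bm{s}\|_2\le\epsilon$. Suppose that for some integer $t>1$ the isometry constant $\delta_{tk}$ of $\mathcal{A}$ satisfies $$\delta_{tk}<\sqrt{\frac{t-1}{t+\theta_k^2-1}},\qquad \theta_k=\frac{\sqrt k+\sqrt2-1}{\sqrt k-\sqrt2-1}.$$ Let $\bm{X}^*$ be a global minimizer over $\bm{X}\in\mathbb{R}^{m\times n}$ of $$\mathcal{J}(\bm{X})=\|\bm{X}\|_*-\|\bm{X}\|_F+\frac1{2\lambda}\|\mathcal{A}(\bm{X})-\bm{b}\|_2^2 .$$ Then $$\|\bm{X}^*-\bm{X}^o\|_F\le C_1\|\bm{X}^o\|_*+C_2\lambda,$$ where $$C_1=\frac{2(\hat\beta_1\hat\gamma_1+\xi_1)}{\sqrt k(1-\beta_1)\hat\gamma_1\kappa_1},\qquad C_2=\frac{2\xi_1\hat\gamma_1}{\sqrt k(1-\beta_1)\kappa_1},$$ with $$\beta_1=\frac{\delta_{tk}}{\sqrt{(t-1)(1-\delta_{tk}^2)}},\quad \gamma_1=\frac{2}{(1-\delta_{tk})\sqrt{1+\delta_{tk}}},\quad \hat\beta_1=(\sqrt2-1)\beta_1+1,\quad \eta=\frac{\epsilon}{\lambda},$$ $$\hat\gamma_1=\sqrt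 k\,\gamma_1+\eta,\quad \xi_1=\sqrt{2k}\,\gamma_1+\hat\beta_1\eta,\quad \kappa_1=1-\frac{\hat\beta_1\hat\gamma_1+\xi_1}{\sqrt k(1-\beta_1)\hat\gamma_1}.$$
   Context: $\|\cdot\|_*$ is the nuclear norm (sum of singular values), $\|\cdot\|_F$ the Frobenius norm. For a positive integer $q$, the isometry constant $\delta_q$ of $\mathcal{A}$ is the smallest number such that $(1-\delta_q)\|\bm{X}\|_F^2\le\|\mathcal{A}(\bm{X})\|_2^2\le(1+\delta_q)\|\bm{X}\|_F^2$ for all $\bm{X}\in\mathbb{R}^{m\times n}$ of rank at most $q$ (so for $q\ge\min\{m,n\}$ this ranges over all matrices). *)

theory Defs
  imports "HOL-Analysis.Analysis"
begin

text \<open>An \<open>m \<times> n\<close> real matrix is an element of \<^typ>\<open>real ^ 'n ^ 'm\<close>. The library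
  norm on this type is the Frobenius norm:\<close>

lemma norm_matrix_Frobenius:
  fixes X :: "real ^ 'n ^ 'm"
  shows "norm X = sqrt (\<Sum>i\<in>UNIV. \<Sum>j\<in>UNIV. (X $ i $ j)\<^sup>2)"
  by (simp add: norm_vec_def L2_set_def real_sqrt_pow2 sum_nonneg)

definition singular_space :: "real ^ 'n ^ 'm \<Rightarrow> real \<Rightarrow> (real ^ 'n) set" where
  "singular_space X \<sigma> = {v. (transpose X ** X) *v v = \<sigma>\<^sup>2 *\<^sub>R v}"

definition singular_value :: "real ^ 'n ^ 'm \<Rightarrow> real \<Rightarrow> bool" where
  "singular_value X \<sigma> \<longleftrightarrow> \<sigma> \<ge> 0 \<and> (\<exists>v. v \<noteq> 0 \<and> v \<in> singular_space X \<sigma>)"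

lemma finite_singular_values:
  fixes X :: "real ^ 'n ^ 'm"
  shows "finite {\<sigma>. singular_value X \<sigma>}"
proof -
  define S where "S = {\<sigma>. singular_value X \<sigma>}"
  have "\<exists>v. \<forall>\<sigma>\<in>S. v \<sigma> \<noteq> 0 \<and> v \<sigma> \<in> singular_space X \<sigma>"
    by (intro bchoice) (auto simp: S_def singular_value_def)
  then obtain v where v: "\<And>\<sigma>. \<sigma> \<in> S \<Longrightarrow> v \<sigma> \<noteq> 0"
      "\<And>\<sigma>. \<sigma> \<in> S \<Longrightarrow> v \<sigma> \<in> singular_space X \<sigma>"
    by blast
  have ortho: "orthogonal (v \<sigma>) (v \<tau>)" if "\<sigma> \<in> S" "\<tau> \<in> S" "\<sigma> \<noteq> \<tau>" for \<sigma> \<tau>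
  proof -
    have "((transpose X ** X) *v v \<sigma>) \<bullet> v \<tau> = v \<sigma> \<bullet> ((transpose X ** X) *v v \<tau>)"
      by (metis dot_lmul_matrix inner_commute matrix_vector_mul_assoc transpose_matrix_vector
          transpose_transpose)
    then have "\<sigma>\<^sup>2 * (v \<sigma> \<bullet> v \<tau>) = \<tau>\<^sup>2 * (v \<sigma> \<bullet> v \<tau>)"
      using v(2)[OF that(1)] v(2)[OF that(2)] by (simp add: singular_space_def)
    moreover have "\<sigma>\<^sup>2 \<noteq> \<tau>\<^sup>2"
      using that by (auto simp: S_def singular_value_def)
    ultimately show ?thesis
      by (simp add: orthogonal_def)
  qed
  have inj: "inj_on v S"
    using ortho v(1) by (auto simp: inj_on_def orthogonal_def) (metis inner_eq_zero_iff)
  have "pairwise orthogonal (v ` S)"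
    using ortho by (auto simp: pairwise_def)
  then have "finite (v ` S)"
    by (rule pairwise_orthogonal_imp_finite)
  then show ?thesis
    using inj finite_imageD S_def by blast
qed

text \<open>Singular values are summed with multiplicity. They are the square roots of the eigenvalues
  of \<open>X\<^sup>T X\<close>, whose multiplicities are the dimensions of the eigenspaces because \<open>X\<^sup>T X\<close> is
  symmetric. The singular value \<open>0\<close> does not contribute.\<close>

definition nuclear_norm :: "real ^ 'n ^ 'm \<Rightarrow> real" where
  "nuclear_norm X = (\<Sum>\<sigma> | singular_value X \<sigma>. real (dim (singular_space X \<sigma>)) * \<sigma>)"

definition isometry_bound :: "(real ^ 'n ^ 'm \<Rightarrow> real ^ 'l) \<Rightarrow> nat \<Rightarrow> real \<Rightarrow> bool" where
  "isometry_bound \<A> q d \<longleftrightarrow>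
    (\<forall>X. rank X \<le> q \<longrightarrow>
      (1 - d) * (norm X)\<^sup>2 \<le> (norm (\<A> X))\<^sup>2 \<and> (norm (\<A> X))\<^sup>2 \<le> (1 + d) * (norm X)\<^sup>2)"

definition isometry_constant :: "(real ^ 'n ^ 'm \<Rightarrow> real ^ 'l) \<Rightarrow> nat \<Rightarrow> real" where
  "isometry_constant \<A> q = (LEAST d. isometry_bound \<A> q d)"

text \<open>The least element exists for linear maps and \<open>q \<ge> 1\<close>:\<close>

lemma isometry_constant_least:
  fixes \<A> :: "real ^ 'n ^ 'm \<Rightarrow> real ^ 'l"
  assumes "linear \<A>" and "q \<ge> 1"
  shows "isometry_bound \<A> q (isometry_constant \<A> q)"
    and "\<And>d. isometry_bound \<A> q d \<Longrightarrow> isometry_constant \<A> q \<le> d"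
proof -
  define S where "S = {d. isometry_bound \<A> q d}"
  have S_eq: "S = (\<Inter>X\<in>{X. rank X \<le> q}.
      {d. (1 - d) * (norm X)\<^sup>2 \<le> (norm (\<A> X))\<^sup>2} \<inter> {d. (norm (\<A> X))\<^sup>2 \<le> (1 + d) * (norm X)\<^sup>2})"
    by (auto simp: S_def isometry_bound_def)
  have "closed S"
    unfolding S_eq by (intro closed_INT ballI closed_Int closed_Collect_le continuous_intros)
  obtain B where B: "\<And>X. norm (\<A> X) \<le> B * norm X" "B > 0"
    using linear_bounded_pos[OF assms(1)] by blast
  have "isometry_bound \<A> q (1 + B\<^sup>2)"
    unfolding isometry_bound_def
  proof (intro allI impI conjI)
    fix X :: "real ^ 'n ^ 'm"
    have "(norm (\<A> X))\<^sup>2 \<le> (B * norm X)\<^sup>2"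
      using B(1) by (intro power_mono) auto
    also have "\<dots> = B\<^sup>2 * (norm X)\<^sup>2"
      by (simp add: power_mult_distrib)
    also have "\<dots> \<le> (1 + (1 + B\<^sup>2)) * (norm X)\<^sup>2"
      by (intro mult_right_mono) auto
    finally show "(norm (\<A> X))\<^sup>2 \<le> (1 + (1 + B\<^sup>2)) * (norm X)\<^sup>2" .
    have "(1 - (1 + B\<^sup>2)) * (norm X)\<^sup>2 \<le> 0"
      by simp
    then show "(1 - (1 + B\<^sup>2)) * (norm X)\<^sup>2 \<le> (norm (\<A> X))\<^sup>2"
      by (rule order_trans) simp
  qed
  then have "S \<noteq> {}"
    by (auto simp: S_def)
  obtain X :: "real ^ 'n ^ 'm" where X: "X \<noteq> 0" "rank X \<le> 1"
  proof -
    define X :: "real ^ 'n ^ 'm" where "X = (\<chi> i j. 1)"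
    have "rows X \<subseteq> {\<chi> j. 1}"
      by (auto simp: rows_def row_def X_def)
    then have "dim (rows X) \<le> card {(\<chi> j. 1) :: real ^ 'n}"
      by (intro dim_le_card) (auto intro: span_base)
    then have "rank X \<le> 1"
      by (simp add: row_rank_def)
    moreover have "X \<noteq> 0" by (simp add: X_def vec_eq_iff)
    ultimately show ?thesis using that by blast
  qed
  have "0 \<le> d" if "d \<in> S" for d
  proof -
    have "(1 - d) * (norm X)\<^sup>2 \<le> (1 + d) * (norm X)\<^sup>2"
      using that X(2) assms(2) order_trans unfolding S_def isometry_bound_def by fastforce
    then have "1 - d \<le> 1 + d"
      using X(1) by (simp add: mult_le_cancel_right)
    then show ?thesis by simp
  qed
  then have bdd: "bdd_below S"
    by (intro bdd_belowI)
  have "Inf S \<in> S"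
    using \<open>S \<noteq> {}\<close> bdd \<open>closed S\<close> by (rule closed_contains_Inf)
  moreover have "Inf S \<le> d" if "isometry_bound \<A> q d" for d
    using that bdd by (intro cInf_lower) (auto simp: S_def)
  moreover have "isometry_constant \<A> q = Inf S"
    unfolding isometry_constant_def
    using calculation by (intro Least_equality) (auto simp: S_def)
  ultimately show "isometry_bound \<A> q (isometry_constant \<A> q)"
    and "\<And>d. isometry_bound \<A> q d \<Longrightarrow> isometry_constant \<A> q \<le> d"
    by (auto simp: S_def)
qed

definition objective ::
  "(real ^ 'n ^ 'm \<Rightarrow> real ^ 'l) \<Rightarrow> real ^ 'l \<Rightarrow> real \<Rightarrow> real ^ 'n ^ 'm \<Rightarrow> real" where
  "objective \<A> b lam X =
    nuclear_norm X - norm X + 1 / (2 * lam) * (norm (\<A> X - b))\<^sup>2"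

end

theory Submission
  imports Defs
begin

text \<open>Let \<open>H = Xs - Xo\<close>. Comparing the objective at \<open>Xs\<close> and \<open>Xo\<close> bounds the nuclear norm \<open>N\<close> of \<open>H\<close>
  by \<open>2 * nuclear_norm Xo + norm H\<close> plus a concave quadratic in \<open>a = norm (\<A> H)\<close>. Because the
  estimate charges the whole of \<open>nuclear_norm Xo\<close>, and not only its tail beyond rank \<open>k\<close>, no sharp
  sparse-representation argument is needed: cutting the singular value decomposition of \<open>H\<close> into
  blocks of \<open>t k\<close> decreasing singular values gives
  \<open>norm H \<le> a / sqrt (1 - \<delta>) + (2 + 2 * \<beta>1) * N / sqrt k\<close>. Inserting the first bound and maximizing
  the resulting quadratic over \<open>a\<close> leaves a linear inequality for \<open>norm H\<close>.\<close>

subsection \<open>Orthonormal eigenbases of self-adjoint maps\<close>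

text \<open>A maximizer of the Rayleigh quotient on the compact unit sphere of \<open>S\<close> is
  an eigenvector. As \<open>S\<close> is invariant, the residual \<open>w\<close> of the eigenvalue
  equation lies in \<open>S\<close> and is itself an admissible perturbation, which forces
  \<open>w = 0\<close>.\<close>

lemma self_adjoint_eigenvector:
  fixes f :: "'a::euclidean_space \<Rightarrow> 'a"
  assumes lin: "linear f" and sa: "\<And>x y. f x \<bullet> y = x \<bullet> f y"
    and S: "subspace S" "\<And>x. x \<in> S \<Longrightarrow> f x \<in> S" and ne: "S \<noteq> {0}"
  shows "\<exists>v\<in>S. norm v = 1 \<and> (\<exists>c. f v = c *\<^sub>R v)"
proof -
  have cont: "continuous_on X f" for X
    using lin by (simp add: linear_continuous_on linear_conv_bounded_linear)
  have "compact (sphere 0 1 \<inter> S)"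
    using S(1) closed_subspace by (intro compact_Int_closed) auto
  moreover have "sphere 0 1 \<inter> S \<noteq> {}"
  proof -
    obtain x where x: "x \<in> S" "x \<noteq> 0"
      using ne S(1) subspace_0 by blast
    then have "(1 / norm x) *\<^sub>R x \<in> sphere 0 1 \<inter> S"
      using S(1) by (simp add: subspace_scale)
    then show ?thesis by blast
  qed
  ultimately have "\<exists>v\<in>sphere 0 1 \<inter> S. \<forall>y\<in>sphere 0 1 \<inter> S. y \<bullet> f y \<le> v \<bullet> f v"
    by (intro continuous_attains_sup continuous_on_inner continuous_on_id cont)
  then obtain v where v: "v \<in> S" "norm v = 1"
    and mx: "\<And>y. norm y = 1 \<Longrightarrow> y \<in> S \<Longrightarrow> y \<bullet> f y \<le> v \<bullet> f v"
    by auto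
  define c where "c = v \<bullet> f v"
  have le: "y \<bullet> f y \<le> c * (y \<bullet> y)" if "y \<in> S" for y
  proof (cases "y = 0")
    case True
    then show ?thesis using lin by (simp add: linear_0)
  next
    case False
    have "((1 / norm y) *\<^sub>R y) \<bullet> f ((1 / norm y) *\<^sub>R y) \<le> c"
      unfolding c_def using that S(1) False by (intro mx) (auto simp: subspace_scale)
    then have "(y \<bullet> f y) / (norm y)\<^sup>2 \<le> c"
      using lin by (simp add: linear_cmul power2_eq_square)
    then show ?thesis
      using False by (simp add: divide_le_eq power2_norm_eq_inner)
  qed
  define w where "w = f v - c *\<^sub>R v"
  have w: "w \<in> S"
    unfolding w_def using S v by (intro subspace_diff subspace_scale) auto
  \<comment> \<open>First-order condition at the maximum: perturbing \<open>v\<close> by \<open>s w\<close> gains \<open>2 s |w|\<^sup>2\<close> to first order.\<close>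
  define K where "K = w \<bullet> f w - c * (w \<bullet> w)"
  have quad: "2 * s * (w \<bullet> w) + s\<^sup>2 * K \<le> 0" for s
  proof -
    have "(v + s *\<^sub>R w) \<bullet> f (v + s *\<^sub>R w) \<le> c * ((v + s *\<^sub>R w) \<bullet> (v + s *\<^sub>R w))"
      using w v S by (intro le subspace_add subspace_scale) auto
    moreover have "v \<bullet> f w = w \<bullet> f v" "v \<bullet> f v = c" "v \<bullet> v = 1"
      using sa[of v w] v by (auto simp: inner_commute c_def norm_eq_1)
    ultimately have "2 * s * (w \<bullet> f v) + s\<^sup>2 * (w \<bullet> f w) \<le> c * (2 * s * (w \<bullet> v) + s\<^sup>2 * (w \<bullet> w))"
      using lin by (simp add: linear_add linear_cmul inner_add inner_commute algebra_simps power2_eq_square)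
    moreover have e: "w \<bullet> f v = w \<bullet> w + c * (w \<bullet> v)"
      by (subst (2) w_def) (simp add: inner_diff_right)
    ultimately show ?thesis
      unfolding e K_def by (simp add: algebra_simps)
  qed
  have "w \<bullet> w \<le> 0"
  proof (rule ccontr)
    assume "\<not> w \<bullet> w \<le> 0"
    then have p: "w \<bullet> w > 0" by linarith
    \<comment> \<open>Small enough for the linear gain to beat the quadratic term; the
      \<open>+ 1\<close> covers \<open>K = 0\<close>.\<close>
    define s where "s = (w \<bullet> w) / (\<bar>K\<bar> + 1)"
    have s: "s > 0" using p by (simp add: s_def)
    have "2 * s * (w \<bullet> w) \<le> s * (s * \<bar>K\<bar>)"
    proof -
      have "s\<^sup>2 * - K \<le> s\<^sup>2 * \<bar>K\<bar>"
        by (intro mult_left_mono) auto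
      then show ?thesis
        using quad[of s] by (simp add: power2_eq_square mult.assoc)
    qed
    then have "2 * (w \<bullet> w) \<le> s * \<bar>K\<bar>"
      using s by simp
    also have "\<dots> \<le> s * (\<bar>K\<bar> + 1)"
      using s by simp
    also have "\<dots> = w \<bullet> w"
      unfolding s_def by simp
    finally show False using p by simp
  qed
  then have "w = 0"
    by (metis inner_gt_zero_iff not_less)
  then show ?thesis
    using v by (auto simp: w_def)
qed

text \<open>Induction on the dimension: self-adjointness keeps the orthogonal complement
  \<open>S'\<close> of an eigenvector in \<open>S\<close> invariant. The general \<open>S\<close>
  serves this induction.\<close>

lemma self_adjoint_orthonormal_eigenbasis:
  fixes f :: "'a::euclidean_space \<Rightarrow> 'a"
  assumes lin: "linear f" and sa: "\<And>x y. f x \<bullet> y = x \<bullet> f y"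
    and "subspace S" "\<And>x. x \<in> S \<Longrightarrow> f x \<in> S"
  shows "\<exists>B. B \<subseteq> S \<and> pairwise orthogonal B \<and> (\<forall>b\<in>B. norm b = 1 \<and> (\<exists>c. f b = c *\<^sub>R b)) \<and> S \<subseteq> span B"
  using assms(3,4)
proof (induction "dim S" arbitrary: S rule: less_induct)
  case less
  show ?case
  proof (cases "S = {0}")
    case True
    then show ?thesis by (intro exI[of _ "{}"]) auto
  next
    case False
    obtain v c where v: "v \<in> S" "norm v = 1" "f v = c *\<^sub>R v"
      using self_adjoint_eigenvector[OF lin sa less.prems False] by blast
    define S' where "S' = {x \<in> S. v \<bullet> x = 0}"
    have S': "subspace S'"
      using less.prems(1) unfolding S'_def subspace_def by (auto simp: inner_add_right)
    have inv: "f x \<in> S'" if "x \<in> S'" for x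
      using that less.prems(2) sa[of v x] v by (auto simp: S'_def)
    have "v \<notin> S'"
      using v by (auto simp: S'_def norm_eq_1)
    moreover have "S' \<subseteq> S"
      by (auto simp: S'_def)
    ultimately have "S' \<subset> S"
      using v(1) by blast
    then have "dim S' < dim S"
      using S' less.prems(1) by (metis dim_psubset span_eq_iff)
    then obtain B where B: "B \<subseteq> S'" "pairwise orthogonal B"
      "\<forall>b\<in>B. norm b = 1 \<and> (\<exists>c. f b = c *\<^sub>R b)" "S' \<subseteq> span B"
      using less.hyps[OF _ S'] inv by blast
    have "S \<subseteq> span (insert v B)"
    proof
      fix x assume x: "x \<in> S"
      have "x - (v \<bullet> x) *\<^sub>R v \<in> S'"
        using x v less.prems(1) unfolding S'_def
        by (auto simp: inner_diff_right norm_eq_1 intro!: subspace_diff subspace_scale)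
      then have "x - (v \<bullet> x) *\<^sub>R v \<in> span B"
        using B by blast
      then show "x \<in> span (insert v B)"
        by (auto simp: span_insert)
    qed
    moreover have "pairwise orthogonal (insert v B)"
      using B by (auto simp: pairwise_insert S'_def orthogonal_def inner_commute)
    moreover have "insert v B \<subseteq> S"
      using B v by (auto simp: S'_def)
    ultimately show ?thesis
      using B v by (intro exI[of _ "insert v B"]) auto
  qed
qed

definition orthonormal_basis :: "'a::euclidean_space set \<Rightarrow> bool" where
  "orthonormal_basis B \<longleftrightarrow> pairwise orthogonal B \<and> (\<forall>b\<in>B. norm b = 1) \<and> span B = UNIV"

lemma orthonormal_basis_finite: "orthonormal_basis B \<Longrightarrow> finite B"
  unfolding orthonormal_basis_def using pairwise_orthogonal_imp_finite by blast

lemma orthonormal_basis_inner: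
  "orthonormal_basis B \<Longrightarrow> b \<in> B \<Longrightarrow> c \<in> B \<Longrightarrow> b \<bullet> c = (if b = c then 1 else 0)"
  unfolding orthonormal_basis_def pairwise_def orthogonal_def by (auto simp: norm_eq_1)

lemma orthonormal_basis_independent: "orthonormal_basis B \<Longrightarrow> independent B"
  unfolding orthonormal_basis_def by (intro pairwise_orthogonal_independent) auto

lemma orthonormal_basis_expand:
  assumes "orthonormal_basis B"
  shows "(\<Sum>b\<in>B. (b \<bullet> x) *\<^sub>R b) = x"
proof -
  define y where "y = x - (\<Sum>b\<in>B. (b \<bullet> x) *\<^sub>R b)"
  have "y \<bullet> c = 0" if "c \<in> B" for c
  proof -
    have "(\<Sum>b\<in>B. (b \<bullet> x) *\<^sub>R b) \<bullet> c = (\<Sum>b\<in>B. if b = c then c \<bullet> x else 0)"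
      unfolding inner_sum_left using that assms
      by (intro sum.cong) (auto simp: orthonormal_basis_inner)
    also have "\<dots> = c \<bullet> x"
      using that assms by (simp add: orthonormal_basis_finite)
    finally show ?thesis
      by (simp add: y_def inner_diff_left inner_commute[of x c])
  qed
  moreover have "y \<in> span B"
    using assms by (simp add: orthonormal_basis_def)
  ultimately have "orthogonal y y"
    by (intro orthogonal_to_span[of y B y]) (auto simp: orthogonal_def)
  then show ?thesis
    by (simp add: y_def orthogonal_def)
qed

subsection \<open>The nuclear norm as a sum over right singular vectors\<close>

lemma gram_inner:
  fixes X :: "real ^ 'n ^ 'm"
  shows "((transpose X ** X) *v x) \<bullet> y = (X *v x) \<bullet> (X *v y)"
  by (metis dot_lmul_matrix matrix_vector_mul_assoc transpose_matrix_vector)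

text \<open>Encodes a singular value decomposition by its right vectors alone: the singular value at
  \<open>b\<close> is \<open>norm (X *v b)\<close> and the unnormalized left vector is
  \<open>X *v b\<close>, so zero singular values need no separate choice.\<close>

definition right_singular_basis :: "real ^ 'n ^ 'm \<Rightarrow> (real ^ 'n) set \<Rightarrow> bool" where
  "right_singular_basis X B \<longleftrightarrow>
    orthonormal_basis B \<and> (\<forall>b\<in>B. (transpose X ** X) *v b = (norm (X *v b))\<^sup>2 *\<^sub>R b)"

lemma right_singular_basis_exists:
  fixes X :: "real ^ 'n ^ 'm"
  shows "\<exists>B. right_singular_basis X B"
proof -
  let ?f = "\<lambda>x. (transpose X ** X) *v x"
  have "?f x \<bullet> y = x \<bullet> ?f y" for x y
    by (metis gram_inner inner_commute)
  then obtain B where B: "pairwise orthogonal B" "\<forall>b\<in>B. norm b = 1 \<and> (\<exists>c. ?f b = c *\<^sub>R b)" "UNIV \<subseteq> span B"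
    using self_adjoint_orthonormal_eigenbasis[of ?f UNIV] by auto
  have "?f b = (norm (X *v b))\<^sup>2 *\<^sub>R b" if b: "b \<in> B" for b
  proof -
    obtain c where c: "?f b = c *\<^sub>R b" and n: "norm b = 1"
      using B b by blast
    have "(norm (X *v b))\<^sup>2 = ?f b \<bullet> b"
      by (simp add: gram_inner power2_norm_eq_inner)
    also have "\<dots> = c"
      using n by (simp add: c norm_eq_1)
    finally show ?thesis
      using c by simp
  qed
  then show ?thesis
    using B by (auto simp: right_singular_basis_def orthonormal_basis_def)
qed

lemma right_singular_basis_orthogonal:
  assumes "right_singular_basis X B" "b \<in> B" "c \<in> B" "b \<noteq> c"
  shows "(X *v b) \<bullet> (X *v c) = 0"
proof -
  have "(X *v b) \<bullet> (X *v c) = ((transpose X ** X) *v b) \<bullet> c"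
    by (simp only: gram_inner)
  also have "\<dots> = (norm (X *v b))\<^sup>2 * (b \<bullet> c)"
    using assms by (simp add: right_singular_basis_def)
  also have "b \<bullet> c = 0"
    using assms orthonormal_basis_inner[of B b c] by (simp add: right_singular_basis_def)
  finally show ?thesis by simp
qed

text \<open>By symmetry of the Gram matrix, an eigenvector has coordinate zero at every
  \<open>b\<close> with a different eigenvalue. Nonnegativity of \<open>\<sigma>\<close> lets it be
  recovered from its square.\<close>

lemma singular_space_eq_span:
  assumes B: "right_singular_basis X B" and "\<sigma> \<ge> 0"
  shows "singular_space X \<sigma> = span {b \<in> B. norm (X *v b) = \<sigma>}"
proof
  show "span {b \<in> B. norm (X *v b) = \<sigma>} \<subseteq> singular_space X \<sigma>"
  proof (rule span_minimal)
    show "subspace (singular_space X \<sigma>)"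
      by (auto simp: singular_space_def subspace_def matrix_vector_right_distrib scaleR_add_right
          matrix_vector_mult_scaleR)
  qed (use B in \<open>auto simp: singular_space_def right_singular_basis_def\<close>)
next
  have ob: "orthonormal_basis B" using B by (simp add: right_singular_basis_def)
  show "singular_space X \<sigma> \<subseteq> span {b \<in> B. norm (X *v b) = \<sigma>}"
  proof
    fix v assume v: "v \<in> singular_space X \<sigma>"
    have coeff: "b \<bullet> v = 0" if "b \<in> B" "norm (X *v b) \<noteq> \<sigma>" for b
    proof -
      have "((transpose X ** X) *v b) \<bullet> v = b \<bullet> ((transpose X ** X) *v v)"
        by (metis gram_inner inner_commute)
      then have "(norm (X *v b))\<^sup>2 * (b \<bullet> v) = \<sigma>\<^sup>2 * (b \<bullet> v)"
        using B that v by (simp add: right_singular_basis_def singular_space_def)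
      moreover have "(norm (X *v b))\<^sup>2 \<noteq> \<sigma>\<^sup>2"
        using that assms(2) by simp
      ultimately show ?thesis by simp
    qed
    have "v = (\<Sum>b\<in>B. (b \<bullet> v) *\<^sub>R b)"
      using orthonormal_basis_expand[OF ob] by simp
    also have "\<dots> = (\<Sum>b\<in>{b \<in> B. norm (X *v b) = \<sigma>}. (b \<bullet> v) *\<^sub>R b)"
      using coeff ob by (intro sum.mono_neutral_right) (auto simp: orthonormal_basis_finite)
    also have "\<dots> \<in> span {b \<in> B. norm (X *v b) = \<sigma>}"
      by (intro span_sum span_scale span_base) auto
    finally show "v \<in> span {b \<in> B. norm (X *v b) = \<sigma>}" .
  qed
qed

text \<open>Passes from distinct singular values to a sum over vectors: the fibre of
  \<open>B\<close> over \<open>\<sigma>\<close> is a basis of the singular space, so its size is the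
  multiplicity.\<close>

lemma nuclear_norm_eq_sum:
  assumes B: "right_singular_basis X B"
  shows "nuclear_norm X = (\<Sum>b\<in>B. norm (X *v b))"
proof -
  have ob: "orthonormal_basis B" using B by (simp add: right_singular_basis_def)
  have fin: "finite B" using ob by (rule orthonormal_basis_finite)
  define g where "g = (\<lambda>b. norm (X *v b))"
  have ind: "independent {b \<in> B. g b = \<sigma>}" for \<sigma>
    using orthonormal_basis_independent[OF ob] by (rule independent_mono) auto
  have dm: "dim (singular_space X \<sigma>) = card {b \<in> B. g b = \<sigma>}" if "\<sigma> \<ge> 0" for \<sigma>
    using singular_space_eq_span[OF B that] dim_span_eq_card_independent[OF ind]
    by (simp add: g_def)
  have sv: "{\<sigma>. singular_value X \<sigma>} = g ` B"
  proof (intro equalityI subsetI)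
    fix \<sigma> assume "\<sigma> \<in> {\<sigma>. singular_value X \<sigma>}"
    then obtain v where v: "\<sigma> \<ge> 0" "v \<noteq> 0" "v \<in> span {b \<in> B. g b = \<sigma>}"
      using singular_space_eq_span[OF B] by (auto simp: singular_value_def g_def)
    have "{b \<in> B. g b = \<sigma>} \<noteq> {}"
    proof
      assume empty: "{b \<in> B. g b = \<sigma>} = {}"
      show False using v(2,3) unfolding empty by simp
    qed
    then show "\<sigma> \<in> g ` B" by auto
  next
    fix \<sigma> assume "\<sigma> \<in> g ` B"
    then obtain b where b: "b \<in> B" "\<sigma> = g b" by auto
    then have "b \<noteq> 0"
      using ob by (auto simp: orthonormal_basis_def)
    then show "\<sigma> \<in> {\<sigma>. singular_value X \<sigma>}"
      using b B by (auto simp: singular_value_def g_def singular_space_def right_singular_basis_def)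
  qed
  have "nuclear_norm X = (\<Sum>\<sigma>\<in>g ` B. real (card {b \<in> B. g b = \<sigma>}) * \<sigma>)"
    unfolding nuclear_norm_def sv by (intro sum.cong) (auto simp: dm g_def)
  also have "\<dots> = (\<Sum>\<sigma>\<in>g ` B. \<Sum>b\<in>{b \<in> B. g b = \<sigma>}. g b)"
    by (intro sum.cong) auto
  also have "\<dots> = (\<Sum>b\<in>B. g b)"
    using sum.image_gen[OF fin, of g g] by simp
  finally show ?thesis
    by (simp add: g_def)
qed

lemma nuclear_norm_nonneg: "nuclear_norm X \<ge> 0"
  using right_singular_basis_exists[of X] nuclear_norm_eq_sum[of X] by (metis norm_ge_zero sum_nonneg)

text \<open>Norms below 1 are allowed because normalized left singular vectors may be zero. From
  \<open>(norm y)\<^sup>2 \<le> s\<close> and \<open>s = y \<bullet> w\<close>, Cauchy-Schwarz gives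
  \<open>s\<^sup>2 \<le> s * (norm w)\<^sup>2\<close>.\<close>

lemma bessel_inequality:
  fixes u :: "'i \<Rightarrow> 'a::real_inner"
  assumes "finite I" and orth: "\<And>i j. i \<in> I \<Longrightarrow> j \<in> I \<Longrightarrow> i \<noteq> j \<Longrightarrow> u i \<bullet> u j = 0"
    and le: "\<And>i. i \<in> I \<Longrightarrow> norm (u i) \<le> 1"
  shows "(\<Sum>i\<in>I. (u i \<bullet> w)\<^sup>2) \<le> (norm w)\<^sup>2"
proof -
  define y where "y = (\<Sum>i\<in>I. (u i \<bullet> w) *\<^sub>R u i)"
  define s where "s = (\<Sum>i\<in>I. (u i \<bullet> w)\<^sup>2)"
  have "(norm y)\<^sup>2 = (\<Sum>i\<in>I. (norm ((u i \<bullet> w) *\<^sub>R u i))\<^sup>2)"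
    unfolding y_def using assms by (intro norm_sum_Pythagorean) (auto simp: pairwise_def orthogonal_def)
  also have "\<dots> \<le> s"
    unfolding s_def
  proof (rule sum_mono)
    fix i assume "i \<in> I"
    then have "(norm (u i))\<^sup>2 \<le> 1"
      using le by (simp add: power_le_one)
    then show "(norm ((u i \<bullet> w) *\<^sub>R u i))\<^sup>2 \<le> (u i \<bullet> w)\<^sup>2"
      by (simp add: power_mult_distrib mult_left_le)
  qed
  finally have y: "(norm y)\<^sup>2 \<le> s" .
  have s0: "s \<ge> 0" by (simp add: s_def sum_nonneg)
  have "s = y \<bullet> w"
    by (simp add: s_def y_def inner_sum_left power2_eq_square)
  also have "\<dots> \<le> norm y * norm w"
    by (rule norm_cauchy_schwarz)
  finally have "s\<^sup>2 \<le> (norm y * norm w)\<^sup>2"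
    using s0 by (intro power_mono)
  also have "\<dots> \<le> s * (norm w)\<^sup>2"
    using y by (simp add: power_mult_distrib mult_right_mono)
  finally have "s * s \<le> s * (norm w)\<^sup>2"
    by (simp add: power2_eq_square)
  then show ?thesis
    using s0 by (cases "s = 0") (auto simp: s_def[symmetric])
qed

text \<open>The easy half of the duality between the nuclear and the spectral norm: the left-hand side
  is the pairing of \<open>X\<close> with the partial isometry sending \<open>v i\<close> to \<open>u i\<close>.\<close>

lemma sum_inner_le_nuclear_norm:
  fixes X :: "real ^ 'n ^ 'm" and u :: "'i \<Rightarrow> real ^ 'm" and v :: "'i \<Rightarrow> real ^ 'n"
  assumes I: "finite I"
    and u: "\<And>i j. i \<in> I \<Longrightarrow> j \<in> I \<Longrightarrow> i \<noteq> j \<Longrightarrow> u i \<bullet> u j = 0" "\<And>i. i \<in> I \<Longrightarrow> norm (u i) \<le> 1"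
    and v: "\<And>i j. i \<in> I \<Longrightarrow> j \<in> I \<Longrightarrow> i \<noteq> j \<Longrightarrow> v i \<bullet> v j = 0" "\<And>i. i \<in> I \<Longrightarrow> norm (v i) \<le> 1"
  shows "(\<Sum>i\<in>I. u i \<bullet> (X *v v i)) \<le> nuclear_norm X"
proof -
  obtain B where B: "right_singular_basis X B"
    using right_singular_basis_exists by blast
  then have ob: "orthonormal_basis B" by (simp add: right_singular_basis_def)
  \<comment> \<open>Expanding each \<open>v i\<close> in the right singular basis and exchanging the
    sums reduces the claim to a single \<open>b\<close>.\<close>
  have "u i \<bullet> (X *v v i) = (\<Sum>b\<in>B. (v i \<bullet> b) * (u i \<bullet> (X *v b)))" for i
  proof -
    have "X *v v i = X *v (\<Sum>b\<in>B. (b \<bullet> v i) *\<^sub>R b)"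
      using orthonormal_basis_expand[OF ob] by simp
    also have "\<dots> = (\<Sum>b\<in>B. (b \<bullet> v i) *\<^sub>R (X *v b))"
      by (simp add: linear_sum[OF matrix_vector_mul_linear] matrix_vector_mult_scaleR)
    finally show ?thesis
      by (simp add: inner_sum_right inner_commute)
  qed
  then have "(\<Sum>i\<in>I. u i \<bullet> (X *v v i)) = (\<Sum>b\<in>B. \<Sum>i\<in>I. (v i \<bullet> b) * (u i \<bullet> (X *v b)))"
    by (simp add: sum.swap[of _ I B])
  also have "\<dots> \<le> (\<Sum>b\<in>B. norm (X *v b))"
  proof (rule sum_mono)
    fix b assume "b \<in> B"
    then have b: "norm b = 1" using ob by (simp add: orthonormal_basis_def)
    \<comment> \<open>Cauchy-Schwarz over \<open>i\<close>; Bessel then bounds the two factors by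
      \<open>norm b = 1\<close> and \<open>norm (X *v b)\<close>.\<close>
    have "(\<Sum>i\<in>I. (v i \<bullet> b) * (u i \<bullet> (X *v b))) \<le> (\<Sum>i\<in>I. \<bar>v i \<bullet> b\<bar> * \<bar>u i \<bullet> (X *v b)\<bar>)"
      by (intro sum_mono) (simp flip: abs_mult)
    also have "\<dots> \<le> L2_set (\<lambda>i. v i \<bullet> b) I * L2_set (\<lambda>i. u i \<bullet> (X *v b)) I"
      by (rule L2_set_mult_ineq)
    also have "\<dots> \<le> 1 * norm (X *v b)"
    proof (intro mult_mono)
      show "L2_set (\<lambda>i. v i \<bullet> b) I \<le> 1"
        using bessel_inequality[OF I v, where w = b] b by (simp add: L2_set_def)
      show "L2_set (\<lambda>i. u i \<bullet> (X *v b)) I \<le> norm (X *v b)"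
        unfolding L2_set_def using bessel_inequality[OF I u, where w = "X *v b"] by (rule real_le_lsqrt[OF norm_ge_zero])
    qed (auto simp: L2_set_nonneg)
    finally show "(\<Sum>i\<in>I. (v i \<bullet> b) * (u i \<bullet> (X *v b))) \<le> norm (X *v b)" by simp
  qed
  finally show ?thesis
    using nuclear_norm_eq_sum[OF B] by simp
qed

text \<open>The singular vectors of \<open>X - Y\<close> attain its nuclear norm as a pairing that
  is linear in the matrix. Duality bounds the two halves, with the minus sign moved into the left
  vectors.\<close>

lemma nuclear_norm_triangle_diff:
  fixes X Y :: "real ^ 'n ^ 'm"
  shows "nuclear_norm (X - Y) \<le> nuclear_norm X + nuclear_norm Y"
proof -
  obtain B where B: "right_singular_basis (X - Y) B"
    using right_singular_basis_exists by blast
  then have ob: "orthonormal_basis B" by (simp add: right_singular_basis_def)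
  \<comment> \<open>Where the singular value is zero, division by zero makes \<open>u b = 0\<close>,
    and the facts below still hold.\<close>
  define u where "u = (\<lambda>b. (1 / norm ((X - Y) *v b)) *\<^sub>R ((X - Y) *v b))"
  have u: "u b \<bullet> ((X - Y) *v b) = norm ((X - Y) *v b)" "norm (u b) \<le> 1" for b
    by (auto simp: u_def power2_norm_eq_inner[symmetric] power2_eq_square)
  have orth: "u b \<bullet> u c = 0" if "b \<in> B" "c \<in> B" "b \<noteq> c" for b c
    using right_singular_basis_orthogonal[OF B that] by (simp add: u_def)
  note fin = orthonormal_basis_finite[OF ob]
  note inn = orthonormal_basis_inner[OF ob]
  have nrm: "norm b = 1" if "b \<in> B" for b
    using ob that by (simp add: orthonormal_basis_def)
  have "nuclear_norm (X - Y) = (\<Sum>b\<in>B. u b \<bullet> ((X - Y) *v b))"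
    using nuclear_norm_eq_sum[OF B] u by simp
  also have "\<dots> = (\<Sum>b\<in>B. u b \<bullet> (X *v b)) + (\<Sum>b\<in>B. (- u b) \<bullet> (Y *v b))"
    by (simp add: matrix_vector_mult_diff_rdistrib inner_diff_right sum_subtractf sum_negf)
  also have "\<dots> \<le> nuclear_norm X + nuclear_norm Y"
    using orth u(2) inn nrm fin by (intro add_mono sum_inner_le_nuclear_norm) auto
  finally show ?thesis .
qed

subsection \<open>Singular value decomposition into rank-one terms\<close>

definition outer :: "real ^ 'm \<Rightarrow> real ^ 'n \<Rightarrow> real ^ 'n ^ 'm" where
  "outer u v = (\<chi> i j. u $ i * v $ j)"

lemma outer_mult_vec: "outer u v *v x = (v \<bullet> x) *\<^sub>R u"
  by (auto simp: outer_def vec_eq_iff matrix_vector_mult_def inner_vec_def sum_distrib_right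
      intro!: sum.cong)

lemma inner_outer: "outer u v \<bullet> outer u' v' = (u \<bullet> u') * (v \<bullet> v')"
  unfolding outer_def inner_vec_def sum_product by (simp add: mult_ac)

lemma sum_matrix_vector_mult: "(\<Sum>i\<in>S. M i) *v x = (\<Sum>i\<in>S. M i *v (x :: real ^ 'n))"
  by (induction S rule: infinite_finite_induct) (auto simp: matrix_vector_mult_add_rdistrib)

lemma rank_sum_outer_le:
  assumes "finite S"
  shows "rank (\<Sum>i\<in>S. outer (u i) (v i)) \<le> card S"
proof -
  have "range ((*v) (\<Sum>i\<in>S. outer (u i) (v i))) \<subseteq> span (u ` S)"
    by (intro image_subsetI, unfold sum_matrix_vector_mult outer_mult_vec,
        intro span_sum span_scale) (simp add: span_base)
  then have "rank (\<Sum>i\<in>S. outer (u i) (v i)) \<le> card (u ` S)"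
    unfolding rank_dim_range using assms by (intro dim_le_card) auto
  also have "\<dots> \<le> card S"
    using assms by (rule card_image_le)
  finally show ?thesis .
qed

lemma sum_outer_right_singular_basis:
  assumes "right_singular_basis X B"
  shows "(\<Sum>b\<in>B. outer (X *v b) b) = X"
proof -
  have ob: "orthonormal_basis B" using assms by (simp add: right_singular_basis_def)
  have "(\<Sum>b\<in>B. outer (X *v b) b) *v x = X *v x" for x
  proof -
    have "(\<Sum>b\<in>B. outer (X *v b) b) *v x = X *v (\<Sum>b\<in>B. (b \<bullet> x) *\<^sub>R b)"
      by (simp add: sum_matrix_vector_mult outer_mult_vec linear_sum[OF matrix_vector_mul_linear]
          matrix_vector_mult_scaleR)
    then show ?thesis
      by (simp add: orthonormal_basis_expand[OF ob])
  qed
  then show ?thesis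
    by (simp add: matrix_eq)
qed

text \<open>Distinct terms are orthogonal in the Frobenius inner product because their left factors
  are. Allowing subsets gives the norm of every block of the decomposition.\<close>

lemma norm_sum_outer_right_singular_basis:
  assumes B: "right_singular_basis X B" and S: "S \<subseteq> B"
  shows "(norm (\<Sum>b\<in>S. outer (X *v b) b))\<^sup>2 = (\<Sum>b\<in>S. (norm (X *v b))\<^sup>2)"
proof -
  have ob: "orthonormal_basis B" using B by (simp add: right_singular_basis_def)
  have "finite S"
    using S orthonormal_basis_finite[OF ob] finite_subset by blast
  then have "(norm (\<Sum>b\<in>S. outer (X *v b) b))\<^sup>2 = (\<Sum>b\<in>S. (norm (outer (X *v b) b))\<^sup>2)"
    using right_singular_basis_orthogonal[OF B] S
    by (intro norm_sum_Pythagorean) (auto simp: pairwise_def orthogonal_def inner_outer subset_iff)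
  also have "\<dots> = (\<Sum>b\<in>S. (norm (X *v b))\<^sup>2)"
    using S orthonormal_basis_inner[OF ob]
    by (intro sum.cong) (auto simp: power2_norm_eq_inner inner_outer subset_iff)
  finally show ?thesis .
qed

subsection \<open>Isometry bounds against the nuclear norm\<close>

text \<open>Greedy choice: a maximizer over the remaining indices extends the set of the
  \<open>q\<close> largest weights.\<close>

lemma exists_largest_subset:
  fixes g :: "'i \<Rightarrow> real"
  assumes "finite I" "q \<le> card I"
  shows "\<exists>T\<subseteq>I. card T = q \<and> (\<forall>i\<in>T. \<forall>j\<in>I - T. g j \<le> g i)"
  using assms(2)
proof (induction q)
  case 0
  then show ?case by (intro exI[of _ "{}"]) auto
next
  case (Suc q)
  then obtain T where T: "T \<subseteq> I" "card T = q" "\<forall>i\<in>T. \<forall>j\<in>I - T. g j \<le> g i"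
    by auto
  have ne: "I - T \<noteq> {}"
    using T Suc.prems by (metis Diff_eq_empty_iff Suc_n_not_le_n card_mono assms(1) finite_subset le_trans)
  have fin: "finite (g ` (I - T))" "g ` (I - T) \<noteq> {}"
    using assms(1) ne by auto
  obtain m where m: "m \<in> I - T" "g m = Max (g ` (I - T))"
    using Max_in[OF fin] by auto
  have "g j \<le> g m" if "j \<in> I - T" for j
    using that fin m by auto
  then have "\<forall>i\<in>insert m T. \<forall>j\<in>I - insert m T. g j \<le> g i"
    using T by auto
  moreover have "card (insert m T) = Suc q"
    using T m assms(1) finite_subset by fastforce
  ultimately show ?case
    using T m by (intro exI[of _ "insert m T"]) auto
qed

text \<open>The remainder is cut into blocks of \<open>q\<close> decreasing weights; each block is controlled by the
  mean weight of the preceding one.\<close>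

lemma norm_sum_tail_le:
  fixes x :: "'i \<Rightarrow> 'a::real_normed_vector" and g :: "'i \<Rightarrow> real"
  assumes "finite I" and q: "q > 0" and c: "c \<ge> 0" and g: "\<And>i. i \<in> I \<Longrightarrow> g i \<ge> 0"
    and block: "\<And>S m. S \<subseteq> I \<Longrightarrow> card S \<le> q \<Longrightarrow> m \<ge> 0 \<Longrightarrow> (\<And>i. i \<in> S \<Longrightarrow> g i \<le> m) \<Longrightarrow>
      norm (\<Sum>i\<in>S. x i) \<le> c * (sqrt q * m)"
    and T: "T \<subseteq> I" "card T = q" "\<forall>i\<in>T. \<forall>j\<in>I - T. g j \<le> g i"
  shows "norm (\<Sum>i\<in>I - T. x i) \<le> c * ((\<Sum>i\<in>I. g i) / sqrt q)"
  using assms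
proof (induction "card I" arbitrary: I T rule: less_induct)
  case less
  \<comment> \<open>The mean over \<open>T\<close> dominates every weight outside \<open>T\<close>.
    Moreover \<open>sqrt q * m\<close> is the sum over \<open>T\<close> divided by
    \<open>sqrt q\<close>, the source of that denominator.\<close>
  define m where "m = (\<Sum>i\<in>T. g i) / q"
  have fT: "finite T" using less.prems finite_subset by blast
  have m0: "m \<ge> 0"
    unfolding m_def using less.prems by (intro divide_nonneg_nonneg sum_nonneg) auto
  have gm: "g j \<le> m" if "j \<in> I - T" for j
  proof -
    have "real (card T) * g j \<le> (\<Sum>i\<in>T. g i)"
      using less.prems that by (intro sum_bounded_below) auto
    then show ?thesis
      using less.prems q by (simp add: m_def pos_le_divide_eq mult.commute)
  qed
  have sm: "sqrt q * m = (\<Sum>i\<in>T. g i) / sqrt q"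
    using q by (simp add: m_def field_simps)
  have split: "(\<Sum>i\<in>I. g i) = (\<Sum>i\<in>T. g i) + (\<Sum>i\<in>I - T. g i)"
    using less.prems by (metis add.commute sum.subset_diff)
  show ?case
  proof (cases "card (I - T) \<le> q")
    case True
    have "norm (\<Sum>i\<in>I - T. x i) \<le> c * (sqrt q * m)"
      using True m0 gm by (intro less.prems(5)) auto
    also have "\<dots> \<le> c * ((\<Sum>i\<in>I. g i) / sqrt q)"
      unfolding sm split using c less.prems
      by (intro mult_left_mono divide_right_mono) (auto intro: sum_nonneg)
    finally show ?thesis .
  next
    case False
    then obtain T' where T': "T' \<subseteq> I - T" "card T' = q" "\<forall>i\<in>T'. \<forall>j\<in>(I - T) - T'. g j \<le> g i"
      using exists_largest_subset[of "I - T" q g] less.prems by (meson finite_Diff nat_le_linear)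
    have "T \<noteq> {}" using less.prems by auto
    then have smaller: "card (I - T) < card I"
      using less.prems(1,6) by (intro psubset_card_mono) auto
    \<comment> \<open>The next block \<open>T'\<close> is paid for by the weights of
      \<open>T\<close>, the rest by those of \<open>I - T\<close>; the two charges add up exactly to
      the sum over \<open>I\<close>.\<close>
    have IH: "norm (\<Sum>i\<in>(I - T) - T'. x i) \<le> c * ((\<Sum>i\<in>I - T. g i) / sqrt q)"
    proof (rule less.hyps[OF smaller _ q c])
      show "norm (\<Sum>i\<in>S. x i) \<le> c * (sqrt q * m')"
        if "S \<subseteq> I - T" "card S \<le> q" "m' \<ge> 0" "\<And>i. i \<in> S \<Longrightarrow> g i \<le> m'" for S m'
        using that(1) by (intro less.prems(5)[OF _ that(2,3,4)]) auto
      show "finite (I - T)" using less.prems(1) by simp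
      show "g i \<ge> 0" if "i \<in> I - T" for i using that less.prems(4) by simp
    qed (fact T')+
    have "norm (\<Sum>i\<in>T'. x i) \<le> c * (sqrt q * m)"
      using T' m0 gm by (intro less.prems(5)) auto
    moreover have "(\<Sum>i\<in>I - T. x i) = (\<Sum>i\<in>(I - T) - T'. x i) + (\<Sum>i\<in>T'. x i)"
      using less.prems T' by (intro sum.subset_diff) auto
    ultimately have "norm (\<Sum>i\<in>I - T. x i) \<le> c * ((\<Sum>i\<in>I - T. g i) / sqrt q) + c * (sqrt q * m)"
      using IH by (simp add: norm_triangle_le)
    also have "\<dots> = c * ((\<Sum>i\<in>I. g i) / sqrt q)"
      unfolding sm split by (simp add: add_divide_distrib distrib_left)
    finally show ?thesis .
  qed
qed

text \<open>A rank-one matrix of norm 1 gives \<open>1 - d \<le> 1 + d\<close>.\<close>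

lemma isometry_bound_nonneg:
  fixes \<A> :: "real ^ 'n ^ 'm \<Rightarrow> real ^ 'l"
  assumes "isometry_bound \<A> q d" "q \<ge> 1"
  shows "d \<ge> 0"
proof -
  obtain u :: "real ^ 'm" and v :: "real ^ 'n" where uv: "norm u = 1" "norm v = 1"
    using vector_choose_size[of 1] by (metis zero_le_one)
  define X where "X = outer u v"
  have "rank X \<le> 1"
    using rank_sum_outer_le[of "{()}" "\<lambda>_. u" "\<lambda>_. v"] by (simp add: X_def)
  then have "(1 - d) * (norm X)\<^sup>2 \<le> (1 + d) * (norm X)\<^sup>2"
    using assms unfolding isometry_bound_def by (meson order_trans)
  moreover have "(norm X)\<^sup>2 = 1"
    using uv by (simp add: X_def power2_norm_eq_inner inner_outer norm_eq_1)
  ultimately show ?thesis by simp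
qed

text \<open>Split \<open>X = Y + R\<close> with \<open>Y\<close> the leading \<open>q\<close> terms
  of the decomposition. The lower isometry bound applies to \<open>Y\<close>, the upper one to each
  block of \<open>R\<close>, and the tail estimate controls both \<open>R\<close> and its
  image.\<close>

lemma isometry_bound_norm_le:
  fixes \<A> :: "real ^ 'n ^ 'm \<Rightarrow> real ^ 'l"
  assumes lin: "linear \<A>" and iso: "isometry_bound \<A> q d" and d: "0 \<le> d" "d < 1" and q: "q > 0"
  shows "sqrt (1 - d) * norm X \<le> norm (\<A> X) + (sqrt (1 + d) + sqrt (1 - d)) * (nuclear_norm X / sqrt q)"
proof -
  obtain B where B: "right_singular_basis X B"
    using right_singular_basis_exists by blast
  then have ob: "orthonormal_basis B" by (simp add: right_singular_basis_def)
  have fin: "finite B" using ob by (rule orthonormal_basis_finite)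
  define N where "N = nuclear_norm X"
  have N: "(\<Sum>b\<in>B. norm (X *v b)) = N"
    using nuclear_norm_eq_sum[OF B] by (simp add: N_def)
  define E where "E = (\<lambda>b. outer (X *v b) b)"
  have rk: "rank (\<Sum>b\<in>S. E b) \<le> q" if "S \<subseteq> B" "card S \<le> q" for S
    unfolding E_def
    by (rule order_trans[OF rank_sum_outer_le that(2)]) (rule finite_subset[OF that(1) fin])
  have up: "norm (\<A> Y) \<le> sqrt (1 + d) * norm Y" if "rank Y \<le> q" for Y
    using iso that d real_sqrt_le_mono[of "(norm (\<A> Y))\<^sup>2" "(1 + d) * (norm Y)\<^sup>2"]
    by (auto simp: isometry_bound_def real_sqrt_mult)
  have low: "sqrt (1 - d) * norm Y \<le> norm (\<A> Y)" if "rank Y \<le> q" for Y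
    using iso that d real_sqrt_le_mono[of "(1 - d) * (norm Y)\<^sup>2" "(norm (\<A> Y))\<^sup>2"]
    by (auto simp: isometry_bound_def real_sqrt_mult)
  \<comment> \<open>The factor 1 is spelled out to match \<open>c\<close> in
    \<open>norm_sum_tail_le\<close>, which is applied to the terms with \<open>c = 1\<close> and to
    their images with \<open>c = sqrt (1 + d)\<close>.\<close>
  have blk: "norm (\<Sum>b\<in>S. E b) \<le> 1 * (sqrt q * m)"
    if S: "S \<subseteq> B" "card S \<le> q" and m: "m \<ge> 0" "\<And>b. b \<in> S \<Longrightarrow> norm (X *v b) \<le> m" for S m
  proof -
    have "(norm (\<Sum>b\<in>S. E b))\<^sup>2 = (\<Sum>b\<in>S. (norm (X *v b))\<^sup>2)"
      unfolding E_def by (rule norm_sum_outer_right_singular_basis[OF B S(1)])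
    also have "\<dots> \<le> real (card S) * m\<^sup>2"
      using m by (intro sum_bounded_above power_mono) auto
    also have "\<dots> \<le> (sqrt q * m)\<^sup>2"
      using S by (simp add: power_mult_distrib mult_right_mono)
    finally have "norm (\<Sum>b\<in>S. E b) \<le> sqrt q * m"
      by (rule power2_le_imp_le) (use m(1) in simp)
    then show ?thesis by simp
  qed
  have blkA: "norm (\<Sum>b\<in>S. \<A> (E b)) \<le> sqrt (1 + d) * (sqrt q * m)"
    if S: "S \<subseteq> B" "card S \<le> q" and m: "m \<ge> 0" "\<And>b. b \<in> S \<Longrightarrow> norm (X *v b) \<le> m" for S m
  proof -
    have "norm (\<Sum>b\<in>S. \<A> (E b)) \<le> sqrt (1 + d) * norm (\<Sum>b\<in>S. E b)"
      using up[OF rk[OF S]] lin by (simp add: linear_sum)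
    also have "\<dots> \<le> sqrt (1 + d) * (sqrt q * m)"
      using blk[OF S m] d by (intro mult_left_mono) auto
    finally show ?thesis .
  qed
  \<comment> \<open>With at most \<open>q\<close> basis vectors, \<open>T = B\<close> leaves an
    empty tail; this covers \<open>q\<close> beyond the matrix dimensions.\<close>
  obtain T where T: "T \<subseteq> B" "card T \<le> q"
    and tail: "norm (\<Sum>b\<in>B - T. E b) \<le> 1 * (N / sqrt q)"
      "norm (\<Sum>b\<in>B - T. \<A> (E b)) \<le> sqrt (1 + d) * (N / sqrt q)"
  proof (cases "card B \<le> q")
    case True
    then show ?thesis
      using d by (intro that[of B]) (auto simp: N_def nuclear_norm_nonneg)
  next
    case False
    then obtain T where T: "T \<subseteq> B" "card T = q"
      "\<forall>i\<in>T. \<forall>j\<in>B - T. norm (X *v j) \<le> norm (X *v i)"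
      using exists_largest_subset[OF fin, of q "\<lambda>b. norm (X *v b)"] by auto
    show ?thesis
    proof (rule that)
      show "norm (\<Sum>b\<in>B - T. E b) \<le> 1 * (N / sqrt q)"
        unfolding N[symmetric] using q by (intro norm_sum_tail_le fin T blk) auto
      show "norm (\<Sum>b\<in>B - T. \<A> (E b)) \<le> sqrt (1 + d) * (N / sqrt q)"
        unfolding N[symmetric] using q d by (intro norm_sum_tail_le fin T blkA) auto
    qed (use T in auto)
  qed
  define Y where "Y = (\<Sum>b\<in>T. E b)"
  define R where "R = (\<Sum>b\<in>B - T. E b)"
  have "(\<Sum>b\<in>B. E b) = X"
    unfolding E_def by (rule sum_outer_right_singular_basis[OF B])
  then have XYR: "X = Y + R"
    using sum.subset_diff[OF T(1) fin, of E] by (simp add: Y_def R_def add.commute)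
  have R: "norm R \<le> N / sqrt q" "norm (\<A> R) \<le> sqrt (1 + d) * (N / sqrt q)"
    using tail lin by (simp_all add: R_def linear_sum)
  have "sqrt (1 - d) * norm X \<le> sqrt (1 - d) * norm Y + sqrt (1 - d) * norm R"
    using d norm_triangle_ineq[of Y R] by (simp add: XYR mult_left_mono flip: distrib_left)
  also have "\<dots> \<le> norm (\<A> Y) + sqrt (1 - d) * (N / sqrt q)"
    using R d low[OF rk[OF T]] unfolding Y_def by (intro add_mono mult_left_mono) auto
  also have "norm (\<A> Y) \<le> norm (\<A> X) + norm (\<A> R)"
    using norm_triangle_ineq4[of "\<A> X" "\<A> R"] lin by (simp add: XYR linear_add)
  also have "norm (\<A> R) \<le> sqrt (1 + d) * (N / sqrt q)"
    by (rule R)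
  finally show ?thesis
    by (simp add: N_def algebra_simps)
qed

subsection \<open>The recovery estimate\<close>

text \<open>Expanding the residual of \<open>Xs\<close> around that of \<open>Xo\<close>, which is
  \<open>- s\<close>, cancels \<open>(norm s)\<^sup>2\<close>. The term
  \<open>- (norm (\<A> (Xs - Xo)))\<^sup>2\<close> is kept: it later caps the terms linear in that
  norm.\<close>

lemma minimizer_nuclear_norm_le:
  fixes \<A> :: "real ^ 'n ^ 'm \<Rightarrow> real ^ 'l"
  assumes lin: "linear \<A>" and lam: "lam > 0" and b: "b = \<A> Xo + s" and s: "norm s \<le> \<epsilon>"
    and opt: "objective \<A> b lam Xs \<le> objective \<A> b lam Xo"
  shows "nuclear_norm (Xs - Xo) \<le> 2 * nuclear_norm Xo + norm (Xs - Xo)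
    + (2 * \<epsilon> * norm (\<A> (Xs - Xo)) - (norm (\<A> (Xs - Xo)))\<^sup>2) / (2 * lam)"
proof -
  define a where "a = norm (\<A> (Xs - Xo))"
  have res: "\<A> Xs - b = \<A> (Xs - Xo) - s" "\<A> Xo - b = - s"
    using lin by (simp_all add: b linear_diff)
  have "(norm (\<A> Xs - b))\<^sup>2 = a\<^sup>2 - 2 * (\<A> (Xs - Xo) \<bullet> s) + (norm s)\<^sup>2"
    unfolding res a_def by (simp add: power2_norm_eq_inner inner_diff inner_commute)
  moreover have "\<A> (Xs - Xo) \<bullet> s \<le> a * \<epsilon>"
    using norm_cauchy_schwarz[of "\<A> (Xs - Xo)" s] s
    unfolding a_def by (meson mult_left_mono norm_ge_zero order_trans)
  ultimately have "(norm s)\<^sup>2 - (norm (\<A> Xs - b))\<^sup>2 \<le> 2 * \<epsilon> * a - a\<^sup>2"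
    by (simp add: algebra_simps)
  then have "((norm s)\<^sup>2 - (norm (\<A> Xs - b))\<^sup>2) / (2 * lam) \<le> (2 * \<epsilon> * a - a\<^sup>2) / (2 * lam)"
    using lam by (intro divide_right_mono) auto
  moreover have "nuclear_norm Xs - norm Xs \<le> nuclear_norm Xo - norm Xo
      + ((norm s)\<^sup>2 - (norm (\<A> Xs - b))\<^sup>2) / (2 * lam)"
    using opt by (simp add: objective_def res(2) diff_divide_distrib)
  moreover have "norm Xs \<le> norm Xo + norm (Xs - Xo)"
    by (rule norm_triangle_sub)
  ultimately show ?thesis
    using nuclear_norm_triangle_diff[of Xs Xo] unfolding a_def by linarith
qed

text \<open>Multiplied by \<open>sqrt (1 + \<delta>)\<close>, the claim reads
  \<open>1 + \<delta> + w \<le> (2 + 2 * \<beta>) * sqrt t * w\<close>. Here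
  \<open>1 \<le> w + \<delta>\<close>, as the square of the right side is
  \<open>1 + 2 * w * \<delta>\<close>, and
  \<open>\<delta> = \<beta> * sqrt (t - 1) * w\<close>.\<close>

lemma isometry_tail_factor:
  fixes \<delta> t :: real
  assumes \<delta>: "0 \<le> \<delta>" "\<delta> < 1" and t: "t > 1"
    and \<beta>: "\<beta> = \<delta> / sqrt ((t - 1) * (1 - \<delta>\<^sup>2))"
  shows "sqrt (1 + \<delta>) + sqrt (1 - \<delta>) \<le> (2 + 2 * \<beta>) * sqrt t * sqrt (1 - \<delta>)"
proof -
  define w where "w = sqrt (1 - \<delta>\<^sup>2)"
  have d2: "1 - \<delta>\<^sup>2 > 0"
    using \<delta> by (simp add: power_less_one_iff abs_square_less_1)
  then have w: "w > 0" "w\<^sup>2 = 1 - \<delta>\<^sup>2"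
    by (simp_all add: w_def)
  have ww: "w = sqrt (1 + \<delta>) * sqrt (1 - \<delta>)"
    unfolding w_def real_sqrt_mult[symmetric] by (simp add: algebra_simps power2_eq_square)
  have "1\<^sup>2 \<le> (w + \<delta>)\<^sup>2"
    using w \<delta> by (simp add: power2_sum)
  then have 1: "1 \<le> w + \<delta>"
    using w \<delta> by (intro power2_le_imp_le[of 1]) auto
  have \<beta>w: "\<beta> * sqrt (t - 1) * w = \<delta>"
    using w t unfolding \<beta> w_def by (simp add: real_sqrt_mult)
  have \<beta>0: "\<beta> \<ge> 0"
    using \<delta> t d2 by (simp add: \<beta>)
  have "\<delta> \<le> \<beta> * sqrt t * w"
    using \<beta>0 w unfolding \<beta>w[symmetric] by (intro mult_right_mono mult_left_mono) auto
  moreover have "w \<le> sqrt t * w"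
    using t w by simp
  ultimately have "2 * w + 2 * \<delta> \<le> (2 + 2 * \<beta>) * sqrt t * w"
    by (simp add: algebra_simps)
  then have "1 + \<delta> + w \<le> (2 + 2 * \<beta>) * sqrt t * w"
    using 1 by linarith
  also have "1 + \<delta> + w = sqrt (1 + \<delta>) * (sqrt (1 + \<delta>) + sqrt (1 - \<delta>))"
    using \<delta> by (simp add: ww distrib_left)
  also have "(2 + 2 * \<beta>) * sqrt t * w = sqrt (1 + \<delta>) * ((2 + 2 * \<beta>) * sqrt t * sqrt (1 - \<delta>))"
    by (simp add: ww)
  finally show ?thesis
    using \<delta> by simp
qed

text \<open>Squared and rearranged, the hypothesis on \<open>\<delta>\<close> says
  \<open>\<beta> * \<theta> < 1\<close>. Then \<open>\<theta> \<ge> 1\<close> yields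
  \<open>\<beta> < 1\<close>, and clearing the denominator of \<open>\<theta>\<close> yields the
  last claim.\<close>

lemma theta_bounds:
  fixes k t \<delta> \<theta> \<beta> :: real
  assumes k: "k \<ge> 6" and t: "t > 1" and \<delta>: "\<delta> \<ge> 0"
    and \<theta>: "\<theta> = (sqrt k + sqrt 2 - 1) / (sqrt k - sqrt 2 - 1)"
    and less: "\<delta> < sqrt ((t - 1) / (t + \<theta>\<^sup>2 - 1))"
    and \<beta>: "\<beta> = \<delta> / sqrt ((t - 1) * (1 - \<delta>\<^sup>2))"
  shows "\<delta> < 1" "\<beta> < 1" "\<beta> * (sqrt k + sqrt 2 - 1) < sqrt k - sqrt 2 - 1"
proof -
  \<comment> \<open>Rational bounds separating \<open>sqrt 2 + 1\<close> from \<open>sqrt 6\<close>,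
    since \<open>71/50 + 1 < 61/25\<close>; this is where \<open>k \<ge> 6\<close> makes the
    denominator of \<open>\<theta>\<close> positive.\<close>
  have "sqrt 2 < (71 / 50 :: real)" "61 / 25 < sqrt (6 :: real)"
    by (rule real_less_lsqrt real_less_rsqrt; simp add: power2_eq_square)+
  moreover have "sqrt 6 \<le> sqrt k"
    using k by simp
  ultimately have p: "sqrt k - sqrt 2 - 1 > 0" by linarith
  have "sqrt 2 > (0::real)" by simp
  then have le: "sqrt k - sqrt 2 - 1 \<le> sqrt k + sqrt 2 - 1" by linarith
  have \<theta>1: "\<theta> \<ge> 1"
    using p le by (simp add: \<theta>)
  have \<theta>2: "\<theta>\<^sup>2 \<ge> 1"
    using \<theta>1 by simp
  have "\<delta>\<^sup>2 < (sqrt ((t - 1) / (t + \<theta>\<^sup>2 - 1)))\<^sup>2"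
    using less \<delta> by (intro power_strict_mono) auto
  also have "\<dots> = (t - 1) / (t + \<theta>\<^sup>2 - 1)"
    using t \<theta>2 by simp
  finally have "\<delta>\<^sup>2 * (t + \<theta>\<^sup>2 - 1) < t - 1"
    using t \<theta>2 by (simp add: pos_less_divide_eq)
  then have key: "\<delta>\<^sup>2 * \<theta>\<^sup>2 < (t - 1) * (1 - \<delta>\<^sup>2)"
    by (simp add: algebra_simps)
  moreover have "0 \<le> \<delta>\<^sup>2 * \<theta>\<^sup>2" by simp
  ultimately have pos: "(t - 1) * (1 - \<delta>\<^sup>2) > 0" by linarith
  then have "\<delta>\<^sup>2 < 1"
    using t by (simp add: zero_less_mult_iff)
  then show "\<delta> < 1"
    using \<delta> by (simp add: abs_square_less_1)
  have "sqrt (\<delta>\<^sup>2 * \<theta>\<^sup>2) < sqrt ((t - 1) * (1 - \<delta>\<^sup>2))"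
    using key by simp
  then have "\<delta> * \<theta> < sqrt ((t - 1) * (1 - \<delta>\<^sup>2))"
    using \<delta> \<theta>1 by (simp add: real_sqrt_mult)
  then have \<beta>\<theta>: "\<beta> * \<theta> < 1"
    using pos by (simp add: \<beta> pos_divide_less_eq)
  have \<beta>0: "\<beta> \<ge> 0"
    using \<delta> pos by (simp add: \<beta>)
  have "\<beta> * 1 \<le> \<beta> * \<theta>"
    using \<beta>0 \<theta>1 by (intro mult_left_mono) auto
  then show "\<beta> < 1"
    using \<beta>\<theta> by simp
  show "\<beta> * (sqrt k + sqrt 2 - 1) < sqrt k - sqrt 2 - 1"
    using \<beta>\<theta> p by (simp add: \<theta> pos_divide_less_eq)
qed

text \<open>With \<open>P\<close> and \<open>D\<close> as in the proof, the two coefficients are \<open>2 D / (P - D)\<close> and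
  \<open>2 \<xi> \<gamma>h\<^sup>2 / (P - D)\<close>, and the condition on \<open>\<beta>\<close> amounts to \<open>\<beta>h + sqrt 2 < r (1 - \<beta>)\<close>, which forces
  \<open>D < P\<close>.\<close>

lemma recovery_constants:
  fixes r M \<sigma> lam \<beta> \<gamma> \<beta>h \<eta> \<gamma>h \<xi> \<kappa> :: real
  assumes r: "r > 0" and \<beta>: "0 \<le> \<beta>" "\<beta> < 1" "\<beta> * (r + sqrt 2 - 1) < r - sqrt 2 - 1"
    and \<gamma>: "\<gamma> > 0" and \<eta>: "\<eta> \<ge> 0" and lam: "lam > 0" and M: "M \<ge> 0" "\<sigma> \<ge> 0"
    and \<beta>h: "\<beta>h = (sqrt 2 - 1) * \<beta> + 1"
    and \<gamma>h: "\<gamma>h = r * \<gamma> + \<eta>"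
    and \<xi>: "\<xi> = sqrt 2 * r * \<gamma> + \<beta>h * \<eta>"
    and \<kappa>: "\<kappa> = 1 - (\<beta>h * \<gamma>h + \<xi>) / (r * (1 - \<beta>) * \<gamma>h)"
    and bound: "r * \<sigma> \<le> (2 + 2 * \<beta>) * (2 * M + \<sigma> + lam * \<gamma>h\<^sup>2 / 2)"
  shows "\<sigma> \<le> 2 * (\<beta>h * \<gamma>h + \<xi>) / (r * (1 - \<beta>) * \<gamma>h * \<kappa>) * M
    + 2 * \<xi> * \<gamma>h / (r * (1 - \<beta>) * \<kappa>) * lam"
proof -
  define P where "P = r * (1 - \<beta>) * \<gamma>h"
  define D where "D = \<beta>h * \<gamma>h + \<xi>"
  have s2: "1 \<le> sqrt 2" by simp
  have \<gamma>h0: "\<gamma>h > 0"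
    using r \<gamma> \<eta> by (simp add: \<gamma>h add_pos_nonneg)
  have P0: "P > 0"
    using r \<beta> \<gamma>h0 by (simp add: P_def)
  have \<beta>h1: "\<beta>h \<ge> 1"
    using \<beta> s2 by (simp add: \<beta>h)
  have "(sqrt 2 - 1) * \<beta> \<le> (sqrt 2 - 1) * 1"
    using s2 \<beta> by (intro mult_left_mono) auto
  then have \<beta>h2: "\<beta>h \<le> sqrt 2"
    by (simp add: \<beta>h algebra_simps)
  \<comment> \<open>Termwise comparison of \<open>\<xi>\<close> with \<open>\<gamma>h\<close>, using
    \<open>1 \<le> \<beta>h \<le> sqrt 2\<close>: the lower bound yields
    \<open>2 * \<gamma>h \<le> D\<close>, the upper one \<open>D < P\<close>.\<close>
  have "1 * (r * \<gamma>) \<le> sqrt 2 * (r * \<gamma>)" "1 * \<eta> \<le> \<beta>h * \<eta>"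
    using s2 r \<gamma> \<beta>h1 \<eta> by (intro mult_right_mono; simp)+
  then have \<xi>1: "\<gamma>h \<le> \<xi>"
    by (simp add: \<xi> \<gamma>h)
  have "\<beta>h * \<eta> \<le> sqrt 2 * \<eta>"
    using \<beta>h2 \<eta> by (intro mult_right_mono)
  then have \<xi>2: "\<xi> \<le> sqrt 2 * \<gamma>h"
    by (simp add: \<xi> \<gamma>h algebra_simps)
  have D2: "2 * \<gamma>h \<le> D"
  proof -
    have "1 * \<gamma>h \<le> \<beta>h * \<gamma>h"
      using \<beta>h1 \<gamma>h0 by (intro mult_right_mono) auto
    then show ?thesis
      using \<xi>1 unfolding D_def by linarith
  qed
  have "D \<le> (\<beta>h + sqrt 2) * \<gamma>h"
    using \<xi>2 by (simp add: D_def algebra_simps)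
  also have "\<dots> < (r * (1 - \<beta>)) * \<gamma>h"
    using \<beta>(3) \<gamma>h0 by (intro mult_strict_right_mono) (auto simp: \<beta>h algebra_simps)
  finally have PD: "D < P"
    by (simp add: P_def)
  have \<rho>: "(1 - \<beta>) * (2 + 2 * \<beta>) \<le> 2"
    using \<beta> by (simp add: algebra_simps)
  define Z where "Z = 2 * M + \<sigma> + lam * \<gamma>h\<^sup>2 / 2"
  have Z0: "Z \<ge> 0"
    using M lam by (simp add: Z_def)
  \<comment> \<open>The factor \<open>(1 - \<beta>) * \<gamma>h\<close> turns the left side of
    \<open>bound\<close> into \<open>P * \<sigma>\<close>. On the right, \<open>\<sigma>\<close>
    ends up with coefficient \<open>D < P\<close> and can be absorbed.\<close>
  have "P * \<sigma> = ((1 - \<beta>) * \<gamma>h) * (r * \<sigma>)"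
    by (simp add: P_def)
  also have "\<dots> \<le> ((1 - \<beta>) * \<gamma>h) * ((2 + 2 * \<beta>) * Z)"
    using bound \<beta> \<gamma>h0 by (intro mult_left_mono) (auto simp: Z_def)
  also have "\<dots> = ((1 - \<beta>) * (2 + 2 * \<beta>)) * (\<gamma>h * Z)"
    by simp
  also have "\<dots> \<le> 2 * (\<gamma>h * Z)"
    using \<rho> \<gamma>h0 Z0 by (intro mult_right_mono) auto
  also have "\<dots> = 2 * \<gamma>h * (2 * M + \<sigma>) + \<gamma>h * \<gamma>h\<^sup>2 * lam"
    by (simp add: Z_def algebra_simps)
  also have "\<dots> \<le> D * (2 * M + \<sigma>) + \<xi> * \<gamma>h\<^sup>2 * (2 * lam)"
    using D2 \<xi>1 M lam \<gamma>h0 by (intro add_mono mult_right_mono mult_mono) auto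
  finally have "(P - D) * \<sigma> \<le> 2 * D * M + 2 * \<xi> * \<gamma>h\<^sup>2 * lam"
    by (simp add: algebra_simps)
  then have "\<sigma> \<le> (2 * D * M + 2 * \<xi> * \<gamma>h\<^sup>2 * lam) / (P - D)"
    using PD by (simp add: pos_le_divide_eq mult.commute)
  also have "\<dots> = 2 * D / (P - D) * M + 2 * \<xi> * \<gamma>h\<^sup>2 / (P - D) * lam"
    by (simp add: add_divide_distrib)
  also have P\<kappa>: "P - D = P * \<kappa>"
    unfolding \<kappa> P_def[symmetric] D_def[symmetric] using P0 by (simp add: right_diff_distrib)
  also have "2 * \<xi> * \<gamma>h\<^sup>2 / (P * \<kappa>) = 2 * \<xi> * \<gamma>h / (r * (1 - \<beta>) * \<kappa>)"
    using \<gamma>h0 by (simp add: P_def power2_eq_square)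
  finally show ?thesis
    by (simp add: P_def D_def)
qed

theorem theorem19:
  fixes \<A> :: "real ^ 'n ^ 'm \<Rightarrow> real ^ 'l"
    and Xo Xs :: "real ^ 'n ^ 'm"
    and b s :: "real ^ 'l"
    and k t :: nat
    and lam \<epsilon> \<delta> \<theta> \<beta>1 \<gamma>1 \<beta>h1 \<eta> \<gamma>h1 \<xi>1 \<kappa>1 C1 C2 :: real
  assumes "linear \<A>"
    and "k \<ge> 6" and "lam > 0" and "\<epsilon> \<ge> 0"
    and "b = \<A> Xo + s" and "norm s \<le> \<epsilon>"
    and "t > 1"
    and "\<delta> = isometry_constant \<A> (t * k)"
    and "\<theta> = (sqrt k + sqrt 2 - 1) / (sqrt k - sqrt 2 - 1)"
    and "\<delta> < sqrt ((real t - 1) / (real t + \<theta>\<^sup>2 - 1))"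
    and "\<forall>X. objective \<A> b lam Xs \<le> objective \<A> b lam X"
    and "\<beta>1 = \<delta> / sqrt ((real t - 1) * (1 - \<delta>\<^sup>2))"
    and "\<gamma>1 = 2 / ((1 - \<delta>) * sqrt (1 + \<delta>))"
    and "\<beta>h1 = (sqrt 2 - 1) * \<beta>1 + 1"
    and "\<eta> = \<epsilon> / lam"
    and "\<gamma>h1 = sqrt k * \<gamma>1 + \<eta>"
    and "\<xi>1 = sqrt (2 * k) * \<gamma>1 + \<beta>h1 * \<eta>"
    and "\<kappa>1 = 1 - (\<beta>h1 * \<gamma>h1 + \<xi>1) / (sqrt k * (1 - \<beta>1) * \<gamma>h1)"
    and "C1 = 2 * (\<beta>h1 * \<gamma>h1 + \<xi>1) / (sqrt k * (1 - \<beta>1) * \<gamma>h1 * \<kappa>1)"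
    and "C2 = 2 * \<xi>1 * \<gamma>h1 / (sqrt k * (1 - \<beta>1) * \<kappa>1)"
  shows "norm (Xs - Xo) \<le> C1 * nuclear_norm Xo + C2 * lam"
proof -
  define H where "H = Xs - Xo"
  define a where "a = norm (\<A> H)"
  define N where "N = nuclear_norm H"
  define M where "M = nuclear_norm Xo"
  define \<sigma> where "\<sigma> = norm H"
  have tk: "t * k \<ge> 1"
    using assms(2,7) by simp
  have iso: "isometry_bound \<A> (t * k) \<delta>"
    unfolding assms(8) by (rule isometry_constant_least(1)[OF assms(1) tk])
  have \<delta>0: "\<delta> \<ge> 0"
    using isometry_bound_nonneg[OF iso tk] .
  have t1: "real t > 1" and k6: "real k \<ge> 6"
    using assms(2,7) by auto
  note th = theta_bounds[OF k6 t1 \<delta>0 assms(9,10,12)]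
  have d2: "1 - \<delta>\<^sup>2 > 0"
    using th(1) \<delta>0 by (simp add: abs_square_less_1)
  have \<beta>0: "\<beta>1 \<ge> 0"
    using \<delta>0 t1 d2 by (simp add: assms(12))
  have k0: "sqrt k > 0" using k6 by simp
  have \<gamma>0: "\<gamma>1 > 0"
    using th(1) \<delta>0 by (simp add: assms(13))
  have \<eta>0: "\<eta> \<ge> 0" using assms(3,4) by (simp add: assms(15))
  \<comment> \<open>The coefficient of \<open>a\<close> after division by
    \<open>sqrt (1 - \<delta>)\<close>. It is enlarged to
    \<open>(2 + 2 * \<beta>1) * \<gamma>1\<close> so that both terms of the estimate share the
    factor \<open>2 + 2 * \<beta>1\<close>.\<close>
  define g where "g = 1 / sqrt (1 - \<delta>)"
  have g0: "g > 0" using th(1) by (simp add: g_def)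
  have "2 * g \<le> \<gamma>1"
  proof -
    have "sqrt (1 - \<delta>) * sqrt (1 + \<delta>) \<le> 1"
      using \<delta>0 by (simp flip: real_sqrt_mult add: algebra_simps)
    then have "sqrt (1 - \<delta>) * (sqrt (1 - \<delta>) * sqrt (1 + \<delta>)) \<le> sqrt (1 - \<delta>) * 1"
      using th(1) by (intro mult_left_mono) auto
    then have "(1 - \<delta>) * sqrt (1 + \<delta>) \<le> sqrt (1 - \<delta>)"
      using th(1) by (simp flip: mult.assoc)
    then have "2 / sqrt (1 - \<delta>) \<le> \<gamma>1"
      using th(1) \<delta>0 by (simp add: assms(13) frac_le)
    then show ?thesis
      by (simp add: g_def)
  qed
  also have "\<gamma>1 \<le> 2 * ((2 + 2 * \<beta>1) * \<gamma>1)"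
    using \<beta>0 \<gamma>0 by simp
  finally have g\<gamma>: "g \<le> (2 + 2 * \<beta>1) * \<gamma>1"
    by linarith
  have N_le: "N \<le> 2 * M + \<sigma> + (2 * \<epsilon> * a - a\<^sup>2) / (2 * lam)"
    unfolding N_def M_def \<sigma>_def a_def H_def
    using assms(11) by (intro minimizer_nuclear_norm_le[OF assms(1,3,5,6)]) auto
  have N0: "N \<ge> 0"
    by (simp add: N_def nuclear_norm_nonneg)
  have "sqrt (1 - \<delta>) * \<sigma> \<le> a + (sqrt (1 + \<delta>) + sqrt (1 - \<delta>)) * (N / sqrt (t * k))"
    unfolding \<sigma>_def a_def N_def using isometry_bound_norm_le[OF assms(1) iso \<delta>0 th(1)] tk by simp
  also have "\<dots> \<le> a + ((2 + 2 * \<beta>1) * sqrt t * sqrt (1 - \<delta>)) * (N / sqrt (t * k))"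
    using isometry_tail_factor[OF \<delta>0 th(1) t1 assms(12)] N0
    by (intro add_left_mono mult_right_mono) auto
  \<comment> \<open>The \<open>sqrt t\<close> of the tail factor cancels against
    \<open>sqrt (t * k)\<close>, leaving the rate \<open>sqrt k\<close>.\<close>
  also have "\<dots> = sqrt (1 - \<delta>) * (g * a + (2 + 2 * \<beta>1) * N / sqrt k)"
  proof -
    have "x + \<rho> * u * w * (N / (u * v)) = w * (1 / w * x + \<rho> * N / v)"
      if "u > 0" "v > 0" "w > 0" for x \<rho> u v w :: real
      using that by (simp add: field_simps)
    from this[of "sqrt t" "sqrt k" "sqrt (1 - \<delta>)"] show ?thesis
      using th(1) t1 k0 by (simp add: g_def real_sqrt_mult)
  qed
  finally have "\<sigma> \<le> g * a + (2 + 2 * \<beta>1) * N / sqrt k"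
    using th(1) by simp
  then have "sqrt k * \<sigma> \<le> sqrt k * (g * a + (2 + 2 * \<beta>1) * N / sqrt k)"
    using k0 by (intro mult_left_mono) auto
  also have "\<dots> = sqrt k * (g * a) + (2 + 2 * \<beta>1) * N"
    using k0 by (simp add: distrib_left)
  also have "\<dots> \<le> sqrt k * ((2 + 2 * \<beta>1) * \<gamma>1 * a)
      + (2 + 2 * \<beta>1) * (2 * M + \<sigma> + (2 * \<epsilon> * a - a\<^sup>2) / (2 * lam))"
    using g\<gamma> N_le \<beta>0 k0 by (intro add_mono mult_left_mono mult_right_mono) (auto simp: a_def)
  \<comment> \<open>The noise contributes \<open>\<eta> * a\<close>, so the coefficient linear in
    \<open>a\<close> is exactly \<open>\<gamma>h1\<close>.\<close>
  also have "\<dots> = (2 + 2 * \<beta>1) * (2 * M + \<sigma> + (\<gamma>h1 * a - a\<^sup>2 / (2 * lam)))"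
    using assms(3) by (simp add: assms(15,16) field_simps)
  \<comment> \<open>Completing the square: the concave quadratic in \<open>a\<close> peaks at
    \<open>a = lam * \<gamma>h1\<close>.\<close>
  also have "\<dots> \<le> (2 + 2 * \<beta>1) * (2 * M + \<sigma> + lam * \<gamma>h1\<^sup>2 / 2)"
  proof -
    have "0 \<le> (a - lam * \<gamma>h1)\<^sup>2 / (2 * lam)"
      using assms(3) by simp
    also have "\<dots> = lam * \<gamma>h1\<^sup>2 / 2 - (\<gamma>h1 * a - a\<^sup>2 / (2 * lam))"
      using assms(3) by (simp add: power2_eq_square field_simps)
    finally show ?thesis
      using \<beta>0 by (intro mult_left_mono add_left_mono) auto
  qed
  finally have "sqrt k * \<sigma> \<le> (2 + 2 * \<beta>1) * (2 * M + \<sigma> + lam * \<gamma>h1\<^sup>2 / 2)" .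
  then have "\<sigma> \<le> C1 * M + C2 * lam"
    unfolding assms(19,20)
    by (intro recovery_constants[OF k0 \<beta>0 th(2,3) \<gamma>0 \<eta>0 assms(3) _ _ assms(14,16) _ assms(18)])
      (auto simp: M_def \<sigma>_def nuclear_norm_nonneg assms(17) real_sqrt_mult)
  then show ?thesis
    by (simp add: \<sigma>_def M_def H_def)
qed

end
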